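(* Consider the infinite-server pricing system, and let $p^*_\infty\in\arg\max_{p\ge 0}\,p\,\overline{G}(p)$ be an optimal uniform price for it. Then the uniform price $p^*_\infty$ (i.e. $p_k=p^*_\infty$ for all $k\ge 0$) maximizes the mean revenue rate of the infinite-server system among all state-dependent price sequences $\mathbf p=(p_k)_{k\ge 0}$, $p_k\in\mathbb{R}_+$: for every such sequence, $R(\infty,\mathbf p)\le R(\infty,p^*_\infty\mathbf 1)=\lambda\,p^*_\infty\,\overline{G}(p^*_\infty)$.
   Context: Infinite-server pricing system: jobs arrive at times $A_n=\sum_{i=1}^n U_i$, where the interarrival times $U_n\ge 0$ are i.i.d. with mean $1/\lambda\in(0,\infty)$. There are infinitely many servers. Job $n$ has service requirement $S_n$ and valuation $V_n$; $(S_n)$ is i.i.d. exponential with mean $1/\mu$, $(V_n)$ is i.i.d., positive, with continuous distribution function $G$ and finite mean; the sequences $(U_n),(S_n),(V_n)$ are mutually independent. The system starts empty. $\overline{G}(u)=P(V_1\ge u)$. If job $n$ finds $Z_n=k$ busy servers on arrival, the posted price is $p_k$; the job is admitted to an idle server and pays $p_k$ if $V_n\ge p_k$, and otherwise leaves forever paying nothing. An admitted job leaves upon service completion. With $N_t$ the number of arrivals in $[0,t]$, the cumulative revenue is $R(t)=\sum_{n=1}^{N_t}p_{Z_n}\mathbf 1_{\{V_n\ge p_{Z_n}\}}$ and the mean revenue rate is $R(\infty,\mathbf p)=\lim_{t\to\infty}\mathbb{E}R(t)/t$ (for sequences $\mathbf p$ for which the limit exists). $p\mathbf 1$ denotes the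 uniform price sequence with all entries equal to $p$. *)

theory Defs
  imports "HOL-Probability.Probability"
begin

text \<open>
  Jobs are numbered \<open>1, 2, 3, \<dots>\<close>; entry \<open>0\<close> of the sequences \<open>u\<close>, \<open>s\<close>, \<open>v\<close> (realisations of
  interarrival times, service requirements and valuations) is never used.
  The dynamics are given path by path, for a price sequence \<open>p\<close>.
\<close>

definition arrival_time :: "(nat \<Rightarrow> real) \<Rightarrow> nat \<Rightarrow> real" where
  "arrival_time u n = (\<Sum>i = 1..n. u i)"

text \<open>
  The busy servers found by job \<open>n\<close> correspond to the earlier jobs \<open>m\<close> that were admitted,
  i.e. whose valuation is at least the price posted to them, and that have not yet completed
  service. Jobs arriving at the same instant are treated in the order of their indices.
\<close>

context
  notes conj_cong [fundef_cong] Collect_cong [fundef_cong]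
begin

function busy_servers ::
    "(nat \<Rightarrow> real) \<Rightarrow> (nat \<Rightarrow> real) \<Rightarrow> (nat \<Rightarrow> real) \<Rightarrow> (nat \<Rightarrow> real) \<Rightarrow> nat \<Rightarrow> nat" where
  "busy_servers p u s v n =
     card {m. m \<in> {1..<n} \<and> p (busy_servers p u s v m) \<le> v m \<and>
              arrival_time u n < arrival_time u m + s m}"
  by pat_completeness auto
termination
  by (relation "Wellfounded.measure (\<lambda>(p, u, s, v, n). n)") auto

end

declare busy_servers.simps [simp del]

definition posted_price ::
    "(nat \<Rightarrow> real) \<Rightarrow> (nat \<Rightarrow> real) \<Rightarrow> (nat \<Rightarrow> real) \<Rightarrow> (nat \<Rightarrow> real) \<Rightarrow> nat \<Rightarrow> real" where
  "posted_price p u s v n = p (busy_servers p u s v n)"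

text \<open>
  Under the assumptions below only finitely many jobs arrive in \<open>[0, t]\<close> almost surely, so that
  the convention \<open>card A = 0\<close> for infinite \<open>A\<close> matters only on a null event.
\<close>

definition num_arrivals :: "(nat \<Rightarrow> real) \<Rightarrow> real \<Rightarrow> nat" where
  "num_arrivals u t = card {n. 1 \<le> n \<and> arrival_time u n \<le> t}"

definition revenue ::
    "(nat \<Rightarrow> real) \<Rightarrow> (nat \<Rightarrow> real) \<Rightarrow> (nat \<Rightarrow> real) \<Rightarrow> (nat \<Rightarrow> real) \<Rightarrow> real \<Rightarrow> real" where
  "revenue p u s v t =
     (\<Sum>n = 1..num_arrivals u t.
        posted_price p u s v n * of_bool (posted_price p u s v n \<le> v n))"

definition expected_revenue ::
    "'a measure \<Rightarrow> (nat \<Rightarrow> 'a \<Rightarrow> real) \<Rightarrow> (nat \<Rightarrow> 'a \<Rightarrow> real) \<Rightarrow> (nat \<Rightarrow> 'a \<Rightarrow> real) \<Rightarrow>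
      (nat \<Rightarrow> real) \<Rightarrow> real \<Rightarrow> real" where
  "expected_revenue M U S V p t =
     (\<integral>\<omega>. revenue p (\<lambda>n. U n \<omega>) (\<lambda>n. S n \<omega>) (\<lambda>n. V n \<omega>) t \<partial>M)"

definition revenue_rate_exists ::
    "'a measure \<Rightarrow> (nat \<Rightarrow> 'a \<Rightarrow> real) \<Rightarrow> (nat \<Rightarrow> 'a \<Rightarrow> real) \<Rightarrow> (nat \<Rightarrow> 'a \<Rightarrow> real) \<Rightarrow>
      (nat \<Rightarrow> real) \<Rightarrow> bool" where
  "revenue_rate_exists M U S V p \<longleftrightarrow>
     (\<exists>r. ((\<lambda>t. expected_revenue M U S V p t / t) \<longlongrightarrow> r) at_top)"

text \<open>Meaningful only if \<^const>\<open>revenue_rate_exists\<close> holds.\<close>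

definition mean_revenue_rate ::
    "'a measure \<Rightarrow> (nat \<Rightarrow> 'a \<Rightarrow> real) \<Rightarrow> (nat \<Rightarrow> 'a \<Rightarrow> real) \<Rightarrow> (nat \<Rightarrow> 'a \<Rightarrow> real) \<Rightarrow>
      (nat \<Rightarrow> real) \<Rightarrow> real" where
  "mean_revenue_rate M U S V p = Lim at_top (\<lambda>t. expected_revenue M U S V p t / t)"

definition valuation_tail :: "'a measure \<Rightarrow> (nat \<Rightarrow> 'a \<Rightarrow> real) \<Rightarrow> real \<Rightarrow> real" where
  "valuation_tail M V x = measure M {\<omega> \<in> space M. x \<le> V 1 \<omega>}"

datatype input = Interarrival | Service | Valuation

locale infinite_server_pricing = prob_space M
  for M :: "'a measure"
    and U S V :: "nat \<Rightarrow> 'a \<Rightarrow> real"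
    and arr_rate srv_rate :: real +
  assumes arr_rate_pos: "0 < arr_rate"
    and srv_rate_pos: "0 < srv_rate"
    and U_indep: "indep_vars (\<lambda>_. borel) U {1..}"
    and U_ident: "\<And>n. 1 \<le> n \<Longrightarrow> distr M borel (U n) = distr M borel (U 1)"
    and U_nonneg: "\<And>n. 1 \<le> n \<Longrightarrow> AE \<omega> in M. 0 \<le> U n \<omega>"
    and U_integrable: "integrable M (U 1)"
    and U_mean: "expectation (U 1) = 1 / arr_rate"
    and S_indep: "indep_vars (\<lambda>_. borel) S {1..}"
    and S_exponential:
      "\<And>n. 1 \<le> n \<Longrightarrow> distributed M lborel (S n) (exponential_density srv_rate)"
    and V_indep: "indep_vars (\<lambda>_. borel) V {1..}"
    and V_ident: "\<And>n. 1 \<le> n \<Longrightarrow> distr M borel (V n) = distr M borel (V 1)"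
    and V_pos: "\<And>n. 1 \<le> n \<Longrightarrow> AE \<omega> in M. 0 < V n \<omega>"
    and V_continuous: "continuous_on UNIV (cdf (distr M borel (V 1)))"
    and V_integrable: "integrable M (V 1)"
    and sequences_indep:
      "indep_vars (\<lambda>_. Pi\<^sub>M {1..} (\<lambda>_. borel))
         (\<lambda>i \<omega>. \<lambda>n\<in>{1..}.
            (case i of Interarrival \<Rightarrow> U n \<omega> | Service \<Rightarrow> S n \<omega> | Valuation \<Rightarrow> V n \<omega>))
         UNIV"

end

theory Submission imports Defs begin

text \<open>
  The valuation of job \<open>n\<close> is independent of the price posted to it and of its arrival time, so an
  arriving job that is offered price \<open>c\<close> pays \<open>c * valuation_tail M V c\<close> on average, which is
  at most its value at the optimal uniform price. Summing over the jobs bounds the expected revenue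
  up to time \<open>t\<close> by the optimum times the expected number of arrivals, with equality for the uniform
  price; the elementary renewal theorem supplies the factor \<open>arr_rate\<close>.
\<close>

subsection \<open>The elementary renewal theorem\<close>

text \<open>The price posted to job \<open>n\<close> depends on interarrival times up to
  \<open>n\<close> and on the services and valuations of all earlier jobs. Separating it from the
  valuation of job \<open>n\<close> therefore takes two layers of independence: between the input
  sequences, and, inside the valuation sequence, between the entries before \<open>n\<close> and
  entry \<open>n\<close>. The comparison of prices is made at each finite horizon; the limit only
  converts the expected number of arrivals into a rate. Prices may be unbounded, so payments are
  integrated in the nonnegative extended reals, where series and integral commute, and finiteness of
  the expected revenue comes out of the bound itself. The expected number of arrivals is handled as
  a series of probabilities. The obstacle to an upper bound is the gap that straddles
  \<open>t\<close>, which can be arbitrarily long. Capping all gaps at a constant bounds the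
  overshoot and only makes events earlier. The cap is held fixed while \<open>t\<close> grows, and
  the capped mean can be brought as close to the true mean as desired.\<close>

lemma arrival_time_0 [simp]: "arrival_time x 0 = 0"
  by (simp add: arrival_time_def)

lemma arrival_time_Suc: "arrival_time x (Suc n) = arrival_time x n + x (Suc n)"
  by (simp add: arrival_time_def)

lemma arrival_time_mono:
  assumes "\<And>n. 0 \<le> x (Suc n)" "m \<le> n"
  shows "arrival_time x m \<le> arrival_time x n"
  using assms(2) by (rule lift_Suc_mono_le[rotated]) (simp add: arrival_time_Suc assms(1))

text \<open>
  The renewal theorem follows by taking expectations in these two bounds: the sum adds up exactly
  the gaps that begin no later than \<open>t\<close>, and each gap is independent of the time at which it begins.
\<close>

lemma sum_gaps_le:
  assumes "\<And>n. 0 \<le> x (Suc n)" "\<And>n. x (Suc n) \<le> c" "0 \<le> t"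
  shows "(\<Sum>n<K. x (Suc n) * of_bool (arrival_time x n \<le> t)) \<le> t + c"
proof -
  have "0 \<le> c" using assms(1,2)[of 0] by linarith
  \<comment> \<open>The bound \<open>t + c\<close> alone is not inductive. With the minimum, a gap
    that begins at \<open>arrival_time x K \<le> t\<close> leads at most to \<open>t + c\<close>,
    and a later one adds nothing.\<close>
  have "(\<Sum>n<K. x (Suc n) * of_bool (arrival_time x n \<le> t)) \<le> min (arrival_time x K) (t + c)"
  proof (induction K)
    case 0
    then show ?case using \<open>0 \<le> c\<close> assms(3) by simp
  next
    case (Suc K)
    show ?case
      using Suc assms(1,2)[of K] by (auto simp: arrival_time_Suc)
  qed
  then show ?thesis by simp
qed

lemma sum_gaps_ge:
  assumes "\<And>n. 0 \<le> x (Suc n)" "0 \<le> t"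
  shows "min (arrival_time x K) t \<le> (\<Sum>n<K. x (Suc n) * of_bool (arrival_time x n \<le> t))"
proof (induction K)
  case 0
  then show ?case using assms by simp
next
  case (Suc K)
  show ?case
    using Suc assms(1)[of K] by (auto simp: arrival_time_Suc)
qed

section \<open>Renewal processes: gaps, event times and their expectations\<close>

locale renewal_process = prob_space M for M :: "'a measure" +
  fixes X :: "nat \<Rightarrow> 'a \<Rightarrow> real"
  assumes indep: "indep_vars (\<lambda>_. borel) X {1..}"
    and ident: "\<And>n. 1 \<le> n \<Longrightarrow> distr M borel (X n) = distr M borel (X 1)"
    and nonneg: "\<And>n. 1 \<le> n \<Longrightarrow> AE \<omega> in M. 0 \<le> X n \<omega>"
    and integrable_1: "integrable M (X 1)"
    and mean_pos: "0 < expectation (X 1)"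
begin

definition event_time :: "nat \<Rightarrow> 'a \<Rightarrow> real" where
  "event_time n \<omega> = arrival_time (\<lambda>i. X i \<omega>) n"

definition event_prob :: "real \<Rightarrow> nat \<Rightarrow> real" where
  "event_prob t n = prob {\<omega> \<in> space M. event_time n \<omega> \<le> t}"

lemma measurable_gap [measurable]: "X (Suc n) \<in> borel_measurable M"
  using indep by (auto simp: indep_vars_def)

lemma measurable_event_time [measurable]: "event_time n \<in> borel_measurable M"
  unfolding event_time_def[abs_def] arrival_time_def
  by (rule borel_measurable_sum) (metis measurable_gap Suc_le_D atLeastAtMost_iff One_nat_def)

lemma integrable_gap: "integrable M (X (Suc n))"
  and expectation_gap: "expectation (X (Suc n)) = expectation (X 1)"
proof -
  have [measurable]: "X 1 \<in> borel_measurable M" using measurable_gap[of 0] by simp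
  have *: "distr M borel (X (Suc n)) = distr M borel (X 1)" by (rule ident) simp
  have "integrable M (X (Suc n)) \<longleftrightarrow> integrable (distr M borel (X (Suc n))) (\<lambda>x. x)"
    by (subst integrable_distr_eq) auto
  also have "\<dots> \<longleftrightarrow> integrable M (X 1)"
    unfolding * by (subst integrable_distr_eq) auto
  finally show "integrable M (X (Suc n))" using integrable_1 by simp
  have "expectation (X (Suc n)) = (\<integral>x. x \<partial>distr M borel (X (Suc n)))"
    by (subst integral_distr) auto
  also have "\<dots> = expectation (X 1)"
    unfolding * by (subst integral_distr) auto
  finally show "expectation (X (Suc n)) = expectation (X 1)" .
qed

lemma gaps_nonneg: "AE \<omega> in M. \<forall>n. 0 \<le> X (Suc n) \<omega>"
  using nonneg by (auto simp: AE_all_countable)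

text \<open>The event time is a sum of the gaps \<open>1..n\<close>, and the gap that begins there
  has index \<open>Suc n\<close>, so the two involve disjoint sets of indices.\<close>

lemma indep_gap_event_time: "indep_var borel (X (Suc n)) borel (event_time n)"
  unfolding event_time_def[abs_def] arrival_time_def
  by (rule indep_vars_sum) (auto intro: indep_vars_subset[OF indep])

lemma expectation_gap_of_bool:
  shows "integrable M (\<lambda>\<omega>. X (Suc n) \<omega> * of_bool (event_time n \<omega> \<le> t))"
    and "expectation (\<lambda>\<omega>. X (Suc n) \<omega> * of_bool (event_time n \<omega> \<le> t)) =
      expectation (X 1) * event_prob t n"
proof -
  have "indep_var borel (id \<circ> X (Suc n)) borel ((\<lambda>a. of_bool (a \<le> t) :: real) \<circ> event_time n)"
    by (rule indep_var_compose[OF indep_gap_event_time]) auto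
  then have ind: "indep_var borel (X (Suc n)) borel (\<lambda>\<omega>. of_bool (event_time n \<omega> \<le> t) :: real)"
    by (simp add: comp_def)
  have int: "integrable M (\<lambda>\<omega>. of_bool (event_time n \<omega> \<le> t) :: real)"
    by (rule integrable_const_bound[where B = 1]) auto
  have "expectation (\<lambda>\<omega>. of_bool (event_time n \<omega> \<le> t)) = event_prob t n"
    unfolding event_prob_def
    by (subst Bochner_Integration.integral_cong[OF refl, 
        where g = "indicator {\<omega> \<in> space M. event_time n \<omega> \<le> t}"]) (auto simp: indicator_def)
  then show "expectation (\<lambda>\<omega>. X (Suc n) \<omega> * of_bool (event_time n \<omega> \<le> t)) =
      expectation (X 1) * event_prob t n"
    by (simp only: indep_var_lebesgue_integral[OF ind integrable_gap int] expectation_gap)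
  show "integrable M (\<lambda>\<omega>. X (Suc n) \<omega> * of_bool (event_time n \<omega> \<le> t))"
    by (rule indep_var_integrable[OF ind integrable_gap int])
qed

text \<open>A form of Wald's identity for the first \<open>K\<close> gaps: the sum of probabilities
  is the expected number of those gaps that begin by time \<open>t\<close>.\<close>

lemma expectation_sum_gaps:
  shows "integrable M (\<lambda>\<omega>. \<Sum>n<K. X (Suc n) \<omega> * of_bool (event_time n \<omega> \<le> t))"
    and "expectation (\<lambda>\<omega>. \<Sum>n<K. X (Suc n) \<omega> * of_bool (event_time n \<omega> \<le> t)) =
      expectation (X 1) * (\<Sum>n<K. event_prob t n)"
proof -
  show "integrable M (\<lambda>\<omega>. \<Sum>n<K. X (Suc n) \<omega> * of_bool (event_time n \<omega> \<le> t))"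
    by (rule Bochner_Integration.integrable_sum) (rule expectation_gap_of_bool)
  show "expectation (\<lambda>\<omega>. \<Sum>n<K. X (Suc n) \<omega> * of_bool (event_time n \<omega> \<le> t)) =
      expectation (X 1) * (\<Sum>n<K. event_prob t n)"
    unfolding Bochner_Integration.integral_sum[OF expectation_gap_of_bool(1)] sum_distrib_left
    by (rule sum.cong[OF refl expectation_gap_of_bool(2)])
qed

lemma sum_event_prob_le_of_bounded:
  assumes "\<And>n \<omega>. X (Suc n) \<omega> \<le> c" "0 \<le> t"
  shows "expectation (X 1) * (\<Sum>n<K. event_prob t n) \<le> t + c"
proof -
  have "AE \<omega> in M. (\<Sum>n<K. X (Suc n) \<omega> * of_bool (event_time n \<omega> \<le> t)) \<le> t + c"
    using gaps_nonneg
  proof (rule eventually_mono)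
    fix \<omega> assume "\<forall>n. 0 \<le> X (Suc n) \<omega>"
    then show "(\<Sum>n<K. X (Suc n) \<omega> * of_bool (event_time n \<omega> \<le> t)) \<le> t + c"
      unfolding event_time_def by (intro sum_gaps_le assms) simp
  qed
  then have "expectation (\<lambda>\<omega>. \<Sum>n<K. X (Suc n) \<omega> * of_bool (event_time n \<omega> \<le> t)) \<le> t + c"
    using expectation_sum_gaps(1) by (intro integral_le_const) 
  then show ?thesis unfolding expectation_sum_gaps(2) .
qed

lemma event_prob_nonneg: "0 \<le> event_prob t n"
  by (simp add: event_prob_def)

lemma event_prob_0: "0 \<le> t \<Longrightarrow> event_prob t 0 = 1"
  by (simp add: event_prob_def event_time_def prob_space)

section \<open>Capping the gaps\<close>

lemma truncated_renewal_process:
  assumes "0 < expectation (\<lambda>\<omega>. min (X 1 \<omega>) c)"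
  shows "renewal_process M (\<lambda>n \<omega>. min (X n \<omega>) c)"
proof
  have 1: "X n \<in> borel_measurable M" if "1 \<le> n" for n
    using indep that by (auto simp: indep_vars_def)
  show "indep_vars (\<lambda>_. borel) (\<lambda>n \<omega>. min (X n \<omega>) c) {1..}"
    by (rule indep_vars_compose2[OF indep]) simp
  show "distr M borel (\<lambda>\<omega>. min (X n \<omega>) c) = distr M borel (\<lambda>\<omega>. min (X 1 \<omega>) c)" if "1 \<le> n" for n
    using arg_cong[OF ident[OF that], of "\<lambda>N. distr N borel (\<lambda>x. min x c)"] 1[OF that] 1[of 1]
    by (simp add: distr_distr comp_def)
  have "AE \<omega> in M. 0 \<le> X 1 \<omega>" by (rule nonneg) simp
  \<comment> \<open>A cap \<open>c \<le> 0\<close> would make the capped gap nonpositive everywhere,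
    against its positive mean. Positivity of \<open>c\<close> is what keeps the capped gaps
    nonnegative.\<close>
  have "0 < c"
  proof (rule ccontr)
    assume "\<not> 0 < c"
    then have "0 \<le> expectation (\<lambda>\<omega>. - min (X 1 \<omega>) c)"
      by (intro integral_nonneg_AE) (auto simp: min_def)
    then show False using assms by simp
  qed
  show "AE \<omega> in M. 0 \<le> min (X n \<omega>) c" if "1 \<le> n" for n
    using nonneg[OF that] by (rule eventually_mono) (simp add: \<open>0 < c\<close> less_imp_le)
  have "integrable M (X 1)" by (rule integrable_1)
  then show "integrable M (\<lambda>\<omega>. min (X 1 \<omega>) c)"
    by (intro integrable_min) auto
qed fact

text \<open>Capping shortens gaps, so every event occurs no later and its probability of occurring
  by \<open>t\<close> can only grow. The capped process has gaps at most \<open>c\<close>, hence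
  overshoot at most \<open>c\<close>.\<close>

lemma sum_event_prob_le:
  assumes c: "0 < expectation (\<lambda>\<omega>. min (X 1 \<omega>) c)" and "0 \<le> t"
  shows "(\<Sum>n<K. event_prob t n) \<le> (t + c) / expectation (\<lambda>\<omega>. min (X 1 \<omega>) c)"
proof -
  interpret T: renewal_process M "\<lambda>n \<omega>. min (X n \<omega>) c"
    by (rule truncated_renewal_process[OF c])
  have "event_prob t n \<le> T.event_prob t n" for n
    unfolding event_prob_def T.event_prob_def
  proof (rule finite_measure_mono)
    show "{\<omega> \<in> space M. event_time n \<omega> \<le> t} \<subseteq> {\<omega> \<in> space M. T.event_time n \<omega> \<le> t}"
    proof safe
      fix \<omega> assume "event_time n \<omega> \<le> t"
      moreover have "T.event_time n \<omega> \<le> event_time n \<omega>"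
        unfolding event_time_def T.event_time_def arrival_time_def by (rule sum_mono) simp
      ultimately show "T.event_time n \<omega> \<le> t" by simp
    qed
  qed measurable
  then have "(\<Sum>n<K. event_prob t n) \<le> (\<Sum>n<K. T.event_prob t n)"
    by (rule sum_mono)
  also have "\<dots> \<le> (t + c) / expectation (\<lambda>\<omega>. min (X 1 \<omega>) c)"
    using T.sum_event_prob_le_of_bounded[of c t K] assms by (simp add: field_simps)
  finally show ?thesis .
qed

text \<open>This removes the cap in the end. It also supplies, since the mean is positive, a cap
  whose capped mean is positive.\<close>

lemma truncated_mean_tendsto:
  "((\<lambda>k. expectation (\<lambda>\<omega>. min (X 1 \<omega>) (real k))) \<longlongrightarrow> expectation (X 1)) sequentially"
proof (rule integral_dominated_convergence)
  show [measurable]: "X 1 \<in> borel_measurable M" using measurable_gap[of 0] by simp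
  show "integrable M (\<lambda>\<omega>. \<bar>X 1 \<omega>\<bar>)" using integrable_1 by simp
  show "(\<lambda>\<omega>. min (X 1 \<omega>) (real k)) \<in> borel_measurable M" for k by measurable
  have "AE \<omega> in M. 0 \<le> X 1 \<omega>" by (rule nonneg) simp
  then show "AE \<omega> in M. norm (min (X 1 \<omega>) (real k)) \<le> \<bar>X 1 \<omega>\<bar>" for k
    by eventually_elim auto
  have "(\<lambda>k. min x (real k)) \<longlonglongrightarrow> x" for x
  proof (rule tendsto_eventually)
    show "\<forall>\<^sub>F k in sequentially. min x (real k) = x"
      using eventually_ge_at_top[of "nat \<lceil>x\<rceil>"] by eventually_elim linarith
  qed
  then show "AE \<omega> in M. (\<lambda>k. min (X 1 \<omega>) (real k)) \<longlonglongrightarrow> X 1 \<omega>" by simp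
qed

lemma summable_event_prob: "summable (event_prob t)"
proof -
  have "\<forall>\<^sub>F k in sequentially. 0 < expectation (\<lambda>\<omega>. min (X 1 \<omega>) (real k))"
    using truncated_mean_tendsto mean_pos by (rule order_tendstoD)
  then obtain k where k: "0 < expectation (\<lambda>\<omega>. min (X 1 \<omega>) (real k))"
    by (auto simp: eventually_sequentially)
  \<comment> \<open>The uniform bound on partial sums is available only for nonnegative times; a
    negative \<open>t\<close> is covered because \<open>event_prob\<close> increases in
    time.\<close>
  have "summable (event_prob (max t 0))"
    by (rule summableI_nonneg_bounded[OF event_prob_nonneg sum_event_prob_le[OF k]]) simp
  then show ?thesis
  proof (rule summable_comparison_test'[where N = 0])
    show "norm (event_prob t n) \<le> event_prob (max t 0) n" for n
      by (auto simp: event_prob_def intro!: finite_measure_mono)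
  qed
qed

section \<open>The renewal function and its linear growth\<close>

definition renewal_function :: "real \<Rightarrow> real" where
  "renewal_function t = (\<Sum>n. event_prob t (Suc n))"

text \<open>The renewal function is the expected number of events with index at least 1 up to time
  \<open>t\<close>, matching the numbering of jobs. Gaps are counted by their starting points, which
  include the origin; this is the extra 1.\<close>

lemma suminf_event_prob: "0 \<le> t \<Longrightarrow> (\<Sum>n. event_prob t n) = renewal_function t + 1"
  using suminf_split_head[OF summable_event_prob[of t]]
  by (simp add: renewal_function_def event_prob_0)

lemma renewal_function_le:
  assumes "0 < expectation (\<lambda>\<omega>. min (X 1 \<omega>) c)" and "0 \<le> t"
  shows "renewal_function t + 1 \<le> (t + c) / expectation (\<lambda>\<omega>. min (X 1 \<omega>) c)"
  using suminf_le_const[OF summable_event_prob sum_event_prob_le[OF assms]] 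
  by (simp add: suminf_event_prob assms)

lemma renewal_function_ge:
  assumes "0 \<le> t"
  shows "t \<le> expectation (X 1) * (renewal_function t + 1)"
\<comment> \<open>Both sides are limits in \<open>K\<close>. On the event that
  \<open>event_time K\<close> exceeds \<open>t\<close>, the gaps beginning by \<open>t\<close>
  already cover \<open>[0, t]\<close>; this event has probability tending to 1, because summable
  probabilities tend to 0.\<close>
proof (rule LIMSEQ_le)
  have "event_prob t \<longlonglongrightarrow> 0" by (rule summable_LIMSEQ_zero[OF summable_event_prob])
  then have "(\<lambda>K. t * (1 - event_prob t K)) \<longlonglongrightarrow> t * (1 - 0)"
    by (intro tendsto_intros)
  then show "(\<lambda>K. t * (1 - event_prob t K)) \<longlonglongrightarrow> t" by simp
  show "(\<lambda>K. expectation (X 1) * (\<Sum>n<K. event_prob t n))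
      \<longlonglongrightarrow> expectation (X 1) * (renewal_function t + 1)"
    using summable_LIMSEQ[OF summable_event_prob[of t]] assms
    by (intro tendsto_intros) (simp add: suminf_event_prob)
  have "t * (1 - event_prob t K) \<le> expectation (X 1) * (\<Sum>n<K. event_prob t n)" for K
  proof -
    have "t * (1 - event_prob t K) = t * prob {\<omega> \<in> space M. \<not> event_time K \<omega> \<le> t}"
      unfolding event_prob_def by (subst prob_neg) auto
    also have "\<dots> = expectation (\<lambda>\<omega>. t * indicator {\<omega> \<in> space M. \<not> event_time K \<omega> \<le> t} \<omega>)"
      by simp
    also have "\<dots> \<le> expectation (\<lambda>\<omega>. \<Sum>n<K. X (Suc n) \<omega> * of_bool (event_time n \<omega> \<le> t))"
    proof (rule integral_mono_AE)
      show "integrable M (\<lambda>\<omega>. t * indicator {\<omega> \<in> space M. \<not> event_time K \<omega> \<le> t} \<omega>)"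
        by (intro integrable_mult_right integrable_real_indicator) (auto simp: emeasure_eq_measure)
      show "AE \<omega> in M. t * indicator {\<omega> \<in> space M. \<not> event_time K \<omega> \<le> t} \<omega>
          \<le> (\<Sum>n<K. X (Suc n) \<omega> * of_bool (event_time n \<omega> \<le> t))"
        using gaps_nonneg
      proof eventually_elim
        case (elim \<omega>)
        have "min (event_time K \<omega>) t \<le> (\<Sum>n<K. X (Suc n) \<omega> * of_bool (event_time n \<omega> \<le> t))"
          unfolding event_time_def using elim assms by (intro sum_gaps_ge) auto
        moreover have "0 \<le> (\<Sum>n<K. X (Suc n) \<omega> * of_bool (event_time n \<omega> \<le> t))"
          using elim by (intro sum_nonneg) auto
        ultimately show ?case by (auto simp: indicator_def)
      qed
    qed (rule expectation_sum_gaps)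
    finally show ?thesis unfolding expectation_sum_gaps(2) .
  qed
  then show "\<exists>N. \<forall>K\<ge>N. t * (1 - event_prob t K) \<le> expectation (X 1) * (\<Sum>n<K. event_prob t n)"
    by blast
qed

theorem elementary_renewal:
  "((\<lambda>t. renewal_function t / t) \<longlongrightarrow> 1 / expectation (X 1)) at_top"
proof (rule order_tendstoI)
  define m where "m = expectation (X 1)"
  have m: "0 < m" using mean_pos by (simp add: m_def)
  fix a assume a: "a < 1 / expectation (X 1)"
  \<comment> \<open>The error \<open>1 / t\<close> is the contribution of the origin, which
    \<open>renewal_function\<close> does not count.\<close>
  have "((\<lambda>t. 1 / m - 1 / t) \<longlongrightarrow> 1 / m - 0) at_top"
    by (intro tendsto_diff tendsto_const tendsto_divide_0[OF tendsto_const] filterlim_at_top_imp_at_infinity filterlim_ident)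
  then have "\<forall>\<^sub>F t in at_top. a < 1 / m - 1 / t"
    using a by (intro order_tendstoD) (auto simp: m_def)
  then show "\<forall>\<^sub>F t in at_top. a < renewal_function t / t"
    using eventually_gt_at_top[of 0]
  proof eventually_elim
    case (elim t)
    have "t / m \<le> renewal_function t + 1"
      using renewal_function_ge[of t] elim m by (simp add: pos_divide_le_eq mult.commute m_def)
    then have "(t / m - 1) / t \<le> renewal_function t / t"
      using elim by (intro divide_right_mono) auto
    moreover have "(t / m - 1) / t = 1 / m - 1 / t"
      using elim by (simp add: diff_divide_distrib)
    ultimately have "1 / m - 1 / t \<le> renewal_function t / t" by simp
    then show ?case using elim by linarith
  qed
next
  define m where "m c = expectation (\<lambda>\<omega>. min (X 1 \<omega>) (real c))" for c
  fix a assume a: "1 / expectation (X 1) < a"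
  have "\<forall>\<^sub>F c in sequentially. 0 < m c"
    unfolding m_def using truncated_mean_tendsto mean_pos by (rule order_tendstoD)
  moreover have "(\<lambda>c. 1 / m c) \<longlonglongrightarrow> 1 / expectation (X 1)"
    unfolding m_def using mean_pos by (intro tendsto_intros truncated_mean_tendsto) auto
  then have "\<forall>\<^sub>F c in sequentially. 1 / m c < a"
    using a by (rule order_tendstoD)
  ultimately have "\<forall>\<^sub>F c in sequentially. 0 < m c \<and> 1 / m c < a" by eventually_elim simp
  \<comment> \<open>The cap is chosen from \<open>a\<close> alone, before \<open>t\<close> grows;
    the overshoot then contributes only the vanishing term
    \<open>(real c / m c) / t\<close>.\<close>
  then obtain c where c: "0 < m c" "1 / m c < a" by (auto simp: eventually_sequentially)
  have "((\<lambda>t. 1 / m c + (real c / m c) / t) \<longlongrightarrow> 1 / m c + 0) at_top"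
    by (intro tendsto_add tendsto_const tendsto_divide_0[OF tendsto_const] filterlim_at_top_imp_at_infinity filterlim_ident)
  then have "\<forall>\<^sub>F t in at_top. 1 / m c + (real c / m c) / t < a"
    using c by (intro order_tendstoD) auto
  then show "\<forall>\<^sub>F t in at_top. renewal_function t / t < a"
    using eventually_gt_at_top[of 0]
  proof eventually_elim
    case (elim t)
    have "renewal_function t \<le> (t + real c) / m c"
      using renewal_function_le[of "real c" t] elim c unfolding m_def by auto
    then have "renewal_function t / t \<le> (t + real c) / m c / t"
      using elim by (intro divide_right_mono) auto
    also have "\<dots> = 1 / m c + (real c / m c) / t"
      using elim c by (simp add: field_simps)
    finally show ?case using elim by linarith
  qed
qed

text \<open>By Borel-Cantelli and summability of the probabilities. It rules out, almost surely, the
  default value of \<open>card\<close> in \<open>num_arrivals\<close>.\<close>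

lemma finite_events: "AE \<omega> in M. finite {n. event_time n \<omega> \<le> t}"
proof -
  have "AE \<omega> in M. \<forall>\<^sub>F n in sequentially. \<omega> \<in> space M - {\<omega> \<in> space M. event_time n \<omega> \<le> t}"
    using summable_event_prob[of t]
    by (intro borel_cantelli_AE1) (auto simp: event_prob_def[abs_def] emeasure_eq_measure)
  then show ?thesis
  proof (rule AE_mp, intro AE_I2 impI)
    fix \<omega> assume "\<omega> \<in> space M"
      and "\<forall>\<^sub>F n in sequentially. \<omega> \<in> space M - {\<omega> \<in> space M. event_time n \<omega> \<le> t}"
    then have "\<forall>\<^sub>F n in cofinite. \<not> event_time n \<omega> \<le> t"
      by (auto simp: cofinite_eq_sequentially elim: eventually_mono)
    then show "finite {n. event_time n \<omega> \<le> t}"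
      by (simp add: eventually_cofinite)
  qed
qed

end


subsection \<open>The revenue\<close>

lemma (in prob_space) nn_integral_indep_var:
  assumes ind: "indep_var S X T Y" and [measurable]: "f \<in> borel_measurable (S \<Otimes>\<^sub>M T)"
  shows "(\<integral>\<^sup>+\<omega>. f (X \<omega>, Y \<omega>) \<partial>M) = (\<integral>\<^sup>+\<omega>. \<integral>\<^sup>+\<omega>'. f (X \<omega>, Y \<omega>') \<partial>M \<partial>M)"
proof -
  have [measurable]: "X \<in> M \<rightarrow>\<^sub>M S" "Y \<in> M \<rightarrow>\<^sub>M T"
    using indep_var_rv1[OF ind] indep_var_rv2[OF ind] .
  interpret Y: prob_space "distr M T Y" by (rule prob_space_distr) measurable
  have "(\<integral>\<^sup>+\<omega>. f (X \<omega>, Y \<omega>) \<partial>M) = (\<integral>\<^sup>+z. f z \<partial>distr M (S \<Otimes>\<^sub>M T) (\<lambda>\<omega>. (X \<omega>, Y \<omega>)))"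
    by (subst nn_integral_distr) auto
  also have "\<dots> = (\<integral>\<^sup>+z. f z \<partial>(distr M S X \<Otimes>\<^sub>M distr M T Y))"
    using ind by (simp add: indep_var_distribution_eq)
  also have "\<dots> = (\<integral>\<^sup>+x. \<integral>\<^sup>+y. f (x, y) \<partial>distr M T Y \<partial>distr M S X)"
    by (subst Y.nn_integral_fst) auto
  also have "\<dots> = (\<integral>\<^sup>+x. \<integral>\<^sup>+\<omega>'. f (x, Y \<omega>') \<partial>M \<partial>distr M S X)"
  proof (rule nn_integral_cong)
    fix x assume "x \<in> space (distr M S X)"
    then have [measurable]: "x \<in> space S" by simp
    show "(\<integral>\<^sup>+y. f (x, y) \<partial>distr M T Y) = (\<integral>\<^sup>+\<omega>'. f (x, Y \<omega>') \<partial>M)"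
      by (subst nn_integral_distr) auto
  qed
  also have "\<dots> = (\<integral>\<^sup>+\<omega>. \<integral>\<^sup>+\<omega>'. f (X \<omega>, Y \<omega>') \<partial>M \<partial>M)"
    by (subst nn_integral_distr) auto
  finally show ?thesis .
qed

text \<open>The two layers of independence are combined here: \<open>Y\<close> is first decoupled
  from \<open>X\<close>, then \<open>Q\<close> from \<open>P\<close> inside \<open>Y\<close>. In the
  application \<open>X\<close> holds arrivals and services, \<open>P\<close> the earlier valuations
  and \<open>Q\<close> the valuation of the current job.\<close>

lemma (in prob_space) nn_integral_indep_component:
  assumes ind: "indep_var S X T Y" and ind': "indep_var A (\<lambda>\<omega>. P (Y \<omega>)) B (\<lambda>\<omega>. Q (Y \<omega>))"
    and [measurable]: "P \<in> T \<rightarrow>\<^sub>M A" "Q \<in> T \<rightarrow>\<^sub>M B" "f \<in> borel_measurable (S \<Otimes>\<^sub>M (A \<Otimes>\<^sub>M B))"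
  shows "(\<integral>\<^sup>+\<omega>. f (X \<omega>, P (Y \<omega>), Q (Y \<omega>)) \<partial>M) =
    (\<integral>\<^sup>+\<omega>. \<integral>\<^sup>+\<omega>'. f (X \<omega>, P (Y \<omega>), Q (Y \<omega>')) \<partial>M \<partial>M)"
proof -
  have [measurable]: "X \<in> M \<rightarrow>\<^sub>M S" "Y \<in> M \<rightarrow>\<^sub>M T"
    using indep_var_rv1[OF ind] indep_var_rv2[OF ind] .
  have "(\<integral>\<^sup>+\<omega>. f (X \<omega>, P (Y \<omega>), Q (Y \<omega>)) \<partial>M) =
      (\<integral>\<^sup>+\<omega>. \<integral>\<^sup>+\<omega>'. f (X \<omega>, P (Y \<omega>'), Q (Y \<omega>')) \<partial>M \<partial>M)"
    using nn_integral_indep_var[OF ind, of "\<lambda>(x, y). f (x, P y, Q y)"] by simp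
  also have "\<dots> = (\<integral>\<^sup>+\<omega>. \<integral>\<^sup>+\<omega>'. \<integral>\<^sup>+\<omega>''. f (X \<omega>, P (Y \<omega>'), Q (Y \<omega>'')) \<partial>M \<partial>M \<partial>M)"
  proof (rule nn_integral_cong)
    fix \<omega> assume "\<omega> \<in> space M"
    then have [measurable]: "X \<omega> \<in> space S" by (auto intro: measurable_space)
    show "(\<integral>\<^sup>+\<omega>'. f (X \<omega>, P (Y \<omega>'), Q (Y \<omega>')) \<partial>M) =
        (\<integral>\<^sup>+\<omega>'. \<integral>\<^sup>+\<omega>''. f (X \<omega>, P (Y \<omega>'), Q (Y \<omega>'')) \<partial>M \<partial>M)"
      using nn_integral_indep_var[OF ind', of "\<lambda>z. f (X \<omega>, z)"] by simp
  qed
  \<comment> \<open>The first decoupling is now undone: with the \<open>Q\<close> component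
    integrated out, \<open>X\<close> and \<open>P (Y _)\<close> return to the same sample
    point.\<close>
  also have "\<dots> = (\<integral>\<^sup>+\<omega>. \<integral>\<^sup>+\<omega>'. f (X \<omega>, P (Y \<omega>), Q (Y \<omega>')) \<partial>M \<partial>M)"
    using nn_integral_indep_var[OF ind, of "\<lambda>(x, y). \<integral>\<^sup>+\<omega>''. f (x, P y, Q (Y \<omega>'')) \<partial>M"] by simp
  finally show ?thesis .
qed

section \<open>Nonanticipation and measurability of the system state\<close>

lemma arrival_time_cong:
  assumes "\<And>i. i \<in> {1..n} \<Longrightarrow> u i = u' i"
  shows "arrival_time u n = arrival_time u' n"
  unfolding arrival_time_def using assms by (rule sum.cong[OF refl])

text \<open>Nonanticipation: the state found by a job involves neither its own valuation nor its own
  service requirement. The half-open ranges are what later separates the price from the valuation of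
  the same job.\<close>

lemma busy_servers_cong:
  assumes "\<And>i. i \<in> {1..n} \<Longrightarrow> u i = u' i"
    and "\<And>i. i \<in> {1..<n} \<Longrightarrow> s i = s' i" "\<And>i. i \<in> {1..<n} \<Longrightarrow> v i = v' i"
  shows "busy_servers p u s v n = busy_servers p u' s' v' n"
  using assms
proof (induction n rule: less_induct)
  case (less n)
  have "busy_servers p u s v m = busy_servers p u' s' v' m" if "m \<in> {1..<n}" for m
    using that by (intro less.IH less.prems) auto
  moreover have "arrival_time u m = arrival_time u' m" if "m \<in> {1..n}" for m
    using that by (intro arrival_time_cong less.prems) auto
  moreover have "arrival_time u n = arrival_time u' n"
    by (intro arrival_time_cong less.prems) auto
  ultimately show ?case
    unfolding busy_servers.simps[of p _ _ _ n]
    by (intro arg_cong[where f = card] Collect_cong conj_cong refl) (auto simp: less.prems)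
qed

lemma measurable_arrival_time:
  assumes "\<And>i. i \<in> {1..n} \<Longrightarrow> (\<lambda>x. u x i) \<in> borel_measurable N"
  shows "(\<lambda>x. arrival_time (u x) n) \<in> borel_measurable N"
  unfolding arrival_time_def using assms by (rule borel_measurable_sum)

text \<open>The source space \<open>N\<close> is left arbitrary because the result is applied both
  to \<open>M\<close> and to the product space on which the inputs are split.\<close>

lemma measurable_busy_servers:
  assumes "\<And>i. i \<in> {1..n} \<Longrightarrow> (\<lambda>x. u x i) \<in> borel_measurable N"
    and "\<And>i. i \<in> {1..<n} \<Longrightarrow> (\<lambda>x. s x i) \<in> borel_measurable N"
    and "\<And>i. i \<in> {1..<n} \<Longrightarrow> (\<lambda>x. v x i) \<in> borel_measurable N"
  shows "(\<lambda>x. busy_servers p (u x) (s x) (v x) n) \<in> N \<rightarrow>\<^sub>M count_space UNIV"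
  using assms
proof (induction n rule: less_induct)
  case (less n)
  have [measurable]: "(\<lambda>x. arrival_time (u x) n) \<in> borel_measurable N"
    by (intro measurable_arrival_time less.prems) auto
  show ?case
    unfolding busy_servers.simps[of p _ _ _ n]
  proof (rule measurable_card)
    fix m
    show "{x \<in> space N. m \<in> {m. m \<in> {1..<n} \<and> p (busy_servers p (u x) (s x) (v x) m) \<le> v x m \<and>
        arrival_time (u x) n < arrival_time (u x) m + s x m}} \<in> sets N"
    proof (cases "m \<in> {1..<n}")
      case True
      have [measurable]: "(\<lambda>x. busy_servers p (u x) (s x) (v x) m) \<in> N \<rightarrow>\<^sub>M count_space UNIV"
        using True by (intro less.IH less.prems) auto
      have [measurable]: "(\<lambda>x. arrival_time (u x) m) \<in> borel_measurable N"
        using True by (intro measurable_arrival_time less.prems) auto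
      have [measurable]: "(\<lambda>x. v x m) \<in> borel_measurable N" "(\<lambda>x. s x m) \<in> borel_measurable N"
        using True by (auto intro: less.prems)
      show ?thesis using True by simp
    qed (simp only: mem_Collect_eq, simp)
  qed
qed

section \<open>The revenue of a path as a series over all jobs\<close>

lemma initial_segment_eq:
  fixes F :: "nat set"
  assumes "finite F" "0 \<notin> F" "\<And>m n. n \<in> F \<Longrightarrow> 1 \<le> m \<Longrightarrow> m \<le> n \<Longrightarrow> m \<in> F"
  shows "F = {1..card F}"
proof (cases "F = {}")
  case False
  have "F = {1..Max F}"
  proof safe
    fix m assume "m \<in> F"
    moreover from this have "m \<noteq> 0" using assms(2) by metis
    ultimately show "m \<in> {1..Max F}" using assms(1) by auto
  next
    fix m assume "m \<in> {1..Max F}"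
    then show "m \<in> F" using assms(3)[of "Max F" m] Max_in[OF assms(1) False] by auto
  qed
  then show ?thesis by (metis card_atLeastAtMost diff_Suc_1)
qed simp

text \<open>A sum with a random number of terms becomes a series with indicator weights, ready for
  termwise integration. Nonnegative gaps make the jobs arrived by \<open>t\<close> an initial
  segment, and finiteness makes its length equal to \<open>num_arrivals\<close>.\<close>

lemma revenue_eq_suminf:
  assumes "\<And>n. 0 \<le> u (Suc n)" "finite {n. arrival_time u n \<le> t}" "\<And>k. 0 \<le> p k"
  shows "ennreal (revenue p u s v t) =
    (\<Sum>n. ennreal (of_bool (arrival_time u (Suc n) \<le> t) *
       (posted_price p u s v (Suc n) * of_bool (posted_price p u s v (Suc n) \<le> v (Suc n)))))"
proof -
  define r where "r n = posted_price p u s v n * of_bool (posted_price p u s v n \<le> v n)" for n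
  have r: "0 \<le> r n" for n using assms(3) by (simp add: r_def posted_price_def)
  have "{n. 1 \<le> n \<and> arrival_time u n \<le> t} = {1..num_arrivals u t}"
    unfolding num_arrivals_def
  proof (rule initial_segment_eq)
    show "finite {n. 1 \<le> n \<and> arrival_time u n \<le> t}"
      by (rule finite_subset[OF _ assms(2)]) auto
    show "m \<in> {n. 1 \<le> n \<and> arrival_time u n \<le> t}"
      if "n \<in> {n. 1 \<le> n \<and> arrival_time u n \<le> t}" "1 \<le> m" "m \<le> n" for m n
      using that arrival_time_mono[of u m n] assms(1) by auto
  qed simp
  then have "Suc n \<in> {n. 1 \<le> n \<and> arrival_time u n \<le> t} \<longleftrightarrow> Suc n \<in> {1..num_arrivals u t}" for n
    by (simp only:)
  then have iff: "arrival_time u (Suc n) \<le> t \<longleftrightarrow> n < num_arrivals u t" for n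
    by (simp add: Suc_le_eq)
  have "(\<Sum>n. ennreal (of_bool (arrival_time u (Suc n) \<le> t) * r (Suc n))) =
      (\<Sum>n<num_arrivals u t. ennreal (of_bool (arrival_time u (Suc n) \<le> t) * r (Suc n)))"
    by (rule suminf_finite) (auto simp: iff)
  also have "\<dots> = (\<Sum>n<num_arrivals u t. ennreal (r (Suc n)))"
    by (rule sum.cong) (auto simp: iff)
  also have "\<dots> = ennreal (\<Sum>n<num_arrivals u t. r (Suc n))"
    using r by (simp add: sum_ennreal)
  also have "(\<Sum>n<num_arrivals u t. r (Suc n)) = revenue p u s v t"
    by (simp only: revenue_def r_def[symmetric] sum.atLeast1_atMost_eq One_nat_def)
  finally show ?thesis by (simp add: r_def)
qed

section \<open>Expected revenue and its comparison with the uniform price\<close>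

context infinite_server_pricing
begin

sublocale arrivals: renewal_process M U
proof
  show "0 < expectation (U 1)" using arr_rate_pos by (simp only: U_mean) simp
qed (fact U_indep U_nonneg U_integrable | rule U_ident, assumption)+

lemma measurable_U: "1 \<le> n \<Longrightarrow> U n \<in> borel_measurable M"
  and measurable_S: "1 \<le> n \<Longrightarrow> S n \<in> borel_measurable M"
  and measurable_V: "1 \<le> n \<Longrightarrow> V n \<in> borel_measurable M"
  using U_indep S_indep V_indep by (auto simp: indep_vars_def)

lemma nn_integral_valuation:
  assumes "1 \<le> n"
  shows "(\<integral>\<^sup>+\<omega>. ennreal (of_bool (c \<le> V n \<omega>)) \<partial>M) = ennreal (valuation_tail M V c)"
proof -
  have "(\<integral>\<^sup>+\<omega>. ennreal (of_bool (c \<le> V n \<omega>)) \<partial>M) = (\<integral>\<^sup>+x. ennreal (of_bool (c \<le> x)) \<partial>distr M borel (V n))"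
    using measurable_V[OF assms] by (subst nn_integral_distr) auto
  also have "\<dots> = (\<integral>\<^sup>+x. ennreal (of_bool (c \<le> x)) \<partial>distr M borel (V 1))"
    unfolding V_ident[OF assms] ..
  also have "\<dots> = (\<integral>\<^sup>+\<omega>. ennreal (of_bool (c \<le> V 1 \<omega>)) \<partial>M)"
    using measurable_V[of 1] by (subst nn_integral_distr) auto
  also have "\<dots> = (\<integral>\<^sup>+\<omega>. indicator {\<omega> \<in> space M. c \<le> V 1 \<omega>} \<omega> \<partial>M)"
    by (rule nn_integral_cong) (auto simp: indicator_def)
  also have "\<dots> = ennreal (valuation_tail M V c)"
    using measurable_V[of 1] by (simp add: valuation_tail_def emeasure_eq_measure)
  finally show ?thesis .
qed

abbreviation price_at :: "(nat \<Rightarrow> real) \<Rightarrow> nat \<Rightarrow> 'a \<Rightarrow> real" where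
  "price_at p n \<omega> \<equiv> posted_price p (\<lambda>n. U n \<omega>) (\<lambda>n. S n \<omega>) (\<lambda>n. V n \<omega>) n"

lemma measurable_price_at: "price_at p n \<in> borel_measurable M"
proof -
  have "(\<lambda>\<omega>. busy_servers p (\<lambda>n. U n \<omega>) (\<lambda>n. S n \<omega>) (\<lambda>n. V n \<omega>) n) \<in> M \<rightarrow>\<^sub>M count_space UNIV"
    by (rule measurable_busy_servers) (auto intro: measurable_U measurable_S measurable_V)
  then show ?thesis unfolding posted_price_def by measurable
qed

lemma measurable_payment:
  assumes "1 \<le> n"
  shows "(\<lambda>\<omega>. price_at p n \<omega> * of_bool (price_at p n \<omega> \<le> V n \<omega>)) \<in> borel_measurable M"
proof -
  have "(\<lambda>\<omega>. g \<omega> * of_bool (g \<omega> \<le> h \<omega>)) \<in> borel_measurable M"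
    if [measurable]: "g \<in> borel_measurable M" "h \<in> borel_measurable M" for g h :: "'a \<Rightarrow> real"
    by measurable
  from this[OF measurable_price_at measurable_V[OF assms]] show ?thesis .
qed

text \<open>The inner integral after decoupling: arrival status and posted price are frozen as
  \<open>B\<close> and \<open>c\<close>, and only the valuation remains random.\<close>

lemma nn_integral_single_payment:
  assumes n: "1 \<le> n" and c: "0 \<le> c"
  shows "(\<integral>\<^sup>+\<omega>. ennreal (of_bool B * (c * of_bool (c \<le> V n \<omega>))) \<partial>M) =
    ennreal (of_bool B * (c * valuation_tail M V c))"
proof -
  have [measurable]: "V n \<in> borel_measurable M" by (rule measurable_V[OF n])
  have "(\<integral>\<^sup>+\<omega>. ennreal (of_bool B * (c * of_bool (c \<le> V n \<omega>))) \<partial>M) =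
      (\<integral>\<^sup>+\<omega>. ennreal (of_bool B * c) * ennreal (of_bool (c \<le> V n \<omega>)) \<partial>M)"
    by (rule nn_integral_cong) (auto simp: c)
  also have "\<dots> = ennreal (of_bool B * c) * (\<integral>\<^sup>+\<omega>. ennreal (of_bool (c \<le> V n \<omega>)) \<partial>M)"
    by (rule nn_integral_cmult) measurable
  also have "\<dots> = ennreal (of_bool B * (c * valuation_tail M V c))"
    unfolding nn_integral_valuation[OF n] using c by (cases B) (simp_all add: ennreal_mult')
  finally show ?thesis .
qed

text \<open>The posted price and the arrival time are functions of arrivals, services and earlier
  valuations only. Conditionally on these the valuation keeps its law, so the acceptance indicator
  may be replaced by its tail probability at the posted price.\<close>

lemma nn_integral_payment:
  assumes n: "1 \<le> n" and p: "\<And>k. 0 \<le> p k"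
  shows "(\<integral>\<^sup>+\<omega>. ennreal (of_bool (arrivals.event_time n \<omega> \<le> t) *
      (price_at p n \<omega> * of_bool (price_at p n \<omega> \<le> V n \<omega>))) \<partial>M) =
    (\<integral>\<^sup>+\<omega>. ennreal (of_bool (arrivals.event_time n \<omega> \<le> t) *
      (price_at p n \<omega> * valuation_tail M V (price_at p n \<omega>))) \<partial>M)"
proof -
  \<comment> \<open>The inputs are packaged in the shape used by \<open>sequences_indep\<close>.
    \<open>X\<close> and \<open>Y\<close> split them by kind, \<open>P\<close> and \<open>Q\<close>
    split the valuations at index \<open>n\<close>, and \<open>f\<close> is the payment as a
    function of the three pieces.\<close>
  define input where
    "input \<omega> i = (\<lambda>n\<in>{1..}. case i of Interarrival \<Rightarrow> U n \<omega> | Service \<Rightarrow> S n \<omega> | Valuation \<Rightarrow> V n \<omega>)"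
    for \<omega> i
  define X where "X \<omega> = restrict (input \<omega>) {Interarrival, Service}" for \<omega>
  define Y where "Y \<omega> = restrict (input \<omega>) {Valuation}" for \<omega>
  define P where "P y = restrict (y Valuation) {1..<n}" for y :: "input \<Rightarrow> nat \<Rightarrow> real"
  define Q where "Q y = restrict (y Valuation) {n}" for y :: "input \<Rightarrow> nat \<Rightarrow> real"
  define price where "price x a = p (busy_servers p (x Interarrival) (x Service) a n)"
    for x :: "input \<Rightarrow> nat \<Rightarrow> real" and a :: "nat \<Rightarrow> real"
  define f where "f = (\<lambda>(x, a, b). ennreal (of_bool (arrival_time (x Interarrival) n \<le> t) *
      (price x a * of_bool (price x a \<le> b n))))"
  let ?S = "Pi\<^sub>M {Interarrival, Service} (\<lambda>_. Pi\<^sub>M {1..} (\<lambda>_. borel)) :: (input \<Rightarrow> nat \<Rightarrow> real) measure"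
  let ?T = "Pi\<^sub>M {Valuation} (\<lambda>_. Pi\<^sub>M {1..} (\<lambda>_. borel)) :: (input \<Rightarrow> nat \<Rightarrow> real) measure"
  let ?A = "Pi\<^sub>M {1..<n} (\<lambda>_. borel) :: (nat \<Rightarrow> real) measure"
  let ?B = "Pi\<^sub>M {n} (\<lambda>_. borel) :: (nat \<Rightarrow> real) measure"
  have ind: "indep_var ?S X ?T Y"
    unfolding X_def[abs_def] Y_def[abs_def] input_def[abs_def]
    by (rule indep_var_restrict[OF sequences_indep]) auto
  have PY: "P (Y \<omega>) = (\<lambda>i\<in>{1..<n}. V i \<omega>)" and QY: "Q (Y \<omega>) = (\<lambda>i\<in>{n}. V i \<omega>)" for \<omega>
    using n by (auto simp: P_def Q_def Y_def input_def restrict_def)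
  have ind': "indep_var ?A (\<lambda>\<omega>. P (Y \<omega>)) ?B (\<lambda>\<omega>. Q (Y \<omega>))"
    unfolding PY QY using n by (intro indep_var_restrict[OF V_indep]) auto
  have valuations: "(\<lambda>y. y Valuation) \<in> ?T \<rightarrow>\<^sub>M Pi\<^sub>M {1..} (\<lambda>_. borel)"
    by (rule measurable_component_singleton) simp
  have P: "P \<in> ?T \<rightarrow>\<^sub>M ?A"
    unfolding P_def[abs_def]
    by (rule measurable_compose[OF valuations measurable_restrict_subset]) auto
  have Q: "Q \<in> ?T \<rightarrow>\<^sub>M ?B"
    unfolding Q_def[abs_def] using n
    by (intro measurable_compose[OF valuations measurable_restrict_subset]) auto
  have x: "(\<lambda>z. fst z j i) \<in> borel_measurable (?S \<Otimes>\<^sub>M (?A \<Otimes>\<^sub>M ?B))"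
    if "j \<in> {Interarrival, Service}" "1 \<le> i" for i j
  proof -
    have "(\<lambda>z. fst z j) \<in> ?S \<Otimes>\<^sub>M (?A \<Otimes>\<^sub>M ?B) \<rightarrow>\<^sub>M Pi\<^sub>M {1..} (\<lambda>_. borel)"
      using that(1) by (rule measurable_compose[OF measurable_fst measurable_component_singleton])
    then show ?thesis
      by (rule measurable_compose[OF _ measurable_component_singleton]) (use that(2) in simp)
  qed
  have a: "(\<lambda>z. fst (snd z) i) \<in> borel_measurable (?S \<Otimes>\<^sub>M (?A \<Otimes>\<^sub>M ?B))" if "i \<in> {1..<n}" for i
    using that by (intro measurable_compose[OF measurable_snd] measurable_compose[OF measurable_fst]
        measurable_component_singleton)
  have val: "(\<lambda>z. snd (snd z) n) \<in> borel_measurable (?S \<Otimes>\<^sub>M (?A \<Otimes>\<^sub>M ?B))"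
    by (intro measurable_compose[OF measurable_snd] measurable_component_singleton) auto
  have busy: "(\<lambda>z. busy_servers p (fst z Interarrival) (fst z Service) (fst (snd z)) n)
      \<in> ?S \<Otimes>\<^sub>M (?A \<Otimes>\<^sub>M ?B) \<rightarrow>\<^sub>M count_space UNIV"
    by (intro measurable_busy_servers x a) auto
  have pr: "(\<lambda>z. p (busy_servers p (fst z Interarrival) (fst z Service) (fst (snd z)) n))
      \<in> borel_measurable (?S \<Otimes>\<^sub>M (?A \<Otimes>\<^sub>M ?B))"
    by (rule measurable_compose[OF busy]) simp
  have arr: "(\<lambda>z. arrival_time (fst z Interarrival) n) \<in> borel_measurable (?S \<Otimes>\<^sub>M (?A \<Otimes>\<^sub>M ?B))"
    by (intro measurable_arrival_time x) auto
  have f: "f \<in> borel_measurable (?S \<Otimes>\<^sub>M (?A \<Otimes>\<^sub>M ?B))"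
  proof -
    have "(\<lambda>z. ennreal (of_bool (g z \<le> t) * (h z * of_bool (h z \<le> k z)))) \<in> borel_measurable N"
      if [measurable]: "g \<in> borel_measurable N" "h \<in> borel_measurable N" "k \<in> borel_measurable N"
      for g h k :: "_ \<Rightarrow> real" and N
      by measurable
    from this[OF arr pr val] show ?thesis
      unfolding f_def price_def case_prod_beta .
  qed
  \<comment> \<open>The restrictions alter the inputs only at indices on which the state found by
    job \<open>n\<close> does not depend.\<close>
  have price: "price (X \<omega>) (P (Y \<omega>)) = price_at p n \<omega>" for \<omega>
    unfolding price_def posted_price_def PY
    by (intro arg_cong[where f = p] busy_servers_cong) (auto simp: X_def input_def)
  have arrival: "arrival_time (X \<omega> Interarrival) n = arrivals.event_time n \<omega>" for \<omega>
    unfolding arrivals.event_time_def by (rule arrival_time_cong) (auto simp: X_def input_def)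
  have p_nonneg: "0 \<le> price_at p n \<omega>" for \<omega> using p by (simp add: posted_price_def)
  have QYn: "Q (Y \<omega>) n = V n \<omega>" for \<omega> by (simp add: QY)
  have "(\<integral>\<^sup>+\<omega>. ennreal (of_bool (arrivals.event_time n \<omega> \<le> t) *
      (price_at p n \<omega> * of_bool (price_at p n \<omega> \<le> V n \<omega>))) \<partial>M) =
      (\<integral>\<^sup>+\<omega>. f (X \<omega>, P (Y \<omega>), Q (Y \<omega>)) \<partial>M)"
    by (simp only: f_def case_prod_conv price arrival QYn)
  also have "\<dots> = (\<integral>\<^sup>+\<omega>. \<integral>\<^sup>+\<omega>'. f (X \<omega>, P (Y \<omega>), Q (Y \<omega>')) \<partial>M \<partial>M)"
    by (rule nn_integral_indep_component[OF ind ind' P Q f])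
  also have "\<dots> = (\<integral>\<^sup>+\<omega>. ennreal (of_bool (arrivals.event_time n \<omega> \<le> t) *
      (price_at p n \<omega> * valuation_tail M V (price_at p n \<omega>))) \<partial>M)"
    by (rule nn_integral_cong)
      (simp only: f_def case_prod_conv price arrival QYn
        nn_integral_single_payment[OF n p_nonneg])
  finally show ?thesis .
qed

lemma nn_integral_arrival:
  assumes "0 \<le> c"
  shows "(\<integral>\<^sup>+\<omega>. ennreal (of_bool (arrivals.event_time n \<omega> \<le> t) * c) \<partial>M) =
    ennreal (arrivals.event_prob t n * c)"
proof -
  have "(\<integral>\<^sup>+\<omega>. ennreal (of_bool (arrivals.event_time n \<omega> \<le> t) * c) \<partial>M) =
      (\<integral>\<^sup>+\<omega>. ennreal c * indicator {\<omega> \<in> space M. arrivals.event_time n \<omega> \<le> t} \<omega> \<partial>M)"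
    by (rule nn_integral_cong) (auto simp: indicator_def)
  also have "\<dots> = ennreal c * ennreal (arrivals.event_prob t n)"
    by (subst nn_integral_cmult) (auto simp: arrivals.event_prob_def emeasure_eq_measure)
  also have "\<dots> = ennreal (arrivals.event_prob t n * c)"
    using ennreal_mult[OF assms arrivals.event_prob_nonneg] by (simp add: mult.commute)
  finally show ?thesis .
qed

lemma measurable_revenue:
  "(\<lambda>\<omega>. revenue p (\<lambda>n. U n \<omega>) (\<lambda>n. S n \<omega>) (\<lambda>n. V n \<omega>) t) \<in> borel_measurable M"
  unfolding revenue_def
proof (rule measurable_compose_countable)
  show "(\<lambda>\<omega>. \<Sum>n = 1..N. price_at p n \<omega> * of_bool (price_at p n \<omega> \<le> V n \<omega>)) \<in> borel_measurable M"
    for N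
  proof (rule borel_measurable_sum)
    fix n assume "n \<in> {1..N}"
    then show "(\<lambda>\<omega>. price_at p n \<omega> * of_bool (price_at p n \<omega> \<le> V n \<omega>)) \<in> borel_measurable M"
      by (intro measurable_payment) auto
  qed
  show "(\<lambda>\<omega>. num_arrivals (\<lambda>n. U n \<omega>) t) \<in> M \<rightarrow>\<^sub>M count_space UNIV"
    unfolding num_arrivals_def
  proof (rule measurable_card)
    fix n
    have "{\<omega> \<in> space M. 1 \<le> n \<and> arrivals.event_time n \<omega> \<le> t} \<in> sets M" by measurable
    then show "{\<omega> \<in> space M. n \<in> {n. 1 \<le> n \<and> arrival_time (\<lambda>n. U n \<omega>) n \<le> t}} \<in> sets M"
      unfolding arrivals.event_time_def mem_Collect_eq .
  qed
qed

text \<open>All terms are nonnegative, so series and integral may be exchanged for every nonnegative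
  price sequence, before the expected revenue is known to be finite.\<close>

lemma nn_integral_revenue:
  assumes p: "\<And>k. 0 \<le> p k"
  shows "(\<integral>\<^sup>+\<omega>. ennreal (revenue p (\<lambda>n. U n \<omega>) (\<lambda>n. S n \<omega>) (\<lambda>n. V n \<omega>) t) \<partial>M) =
    (\<Sum>n. \<integral>\<^sup>+\<omega>. ennreal (of_bool (arrivals.event_time (Suc n) \<omega> \<le> t) *
      (price_at p (Suc n) \<omega> * valuation_tail M V (price_at p (Suc n) \<omega>))) \<partial>M)"
proof -
  have "(\<integral>\<^sup>+\<omega>. ennreal (revenue p (\<lambda>n. U n \<omega>) (\<lambda>n. S n \<omega>) (\<lambda>n. V n \<omega>) t) \<partial>M) =
      (\<integral>\<^sup>+\<omega>. (\<Sum>n. ennreal (of_bool (arrivals.event_time (Suc n) \<omega> \<le> t) *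
        (price_at p (Suc n) \<omega> * of_bool (price_at p (Suc n) \<omega> \<le> V (Suc n) \<omega>)))) \<partial>M)"
  proof (rule nn_integral_cong_AE)
    show "AE \<omega> in M. ennreal (revenue p (\<lambda>n. U n \<omega>) (\<lambda>n. S n \<omega>) (\<lambda>n. V n \<omega>) t) =
      (\<Sum>n. ennreal (of_bool (arrivals.event_time (Suc n) \<omega> \<le> t) *
        (price_at p (Suc n) \<omega> * of_bool (price_at p (Suc n) \<omega> \<le> V (Suc n) \<omega>))))"
      using arrivals.gaps_nonneg arrivals.finite_events[of t]
    proof eventually_elim
      case (elim \<omega>)
      then show ?case
        unfolding arrivals.event_time_def by (intro revenue_eq_suminf p) auto
    qed
  qed
  also have "\<dots> = (\<Sum>n. \<integral>\<^sup>+\<omega>. ennreal (of_bool (arrivals.event_time (Suc n) \<omega> \<le> t) *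
        (price_at p (Suc n) \<omega> * of_bool (price_at p (Suc n) \<omega> \<le> V (Suc n) \<omega>))) \<partial>M)"
  proof (rule nn_integral_suminf)
    fix n
    have [measurable]: "(\<lambda>\<omega>. price_at p (Suc n) \<omega> * of_bool (price_at p (Suc n) \<omega> \<le> V (Suc n) \<omega>)) \<in> borel_measurable M"
      by (rule measurable_payment) simp
    show "(\<lambda>\<omega>. ennreal (of_bool (arrivals.event_time (Suc n) \<omega> \<le> t) *
        (price_at p (Suc n) \<omega> * of_bool (price_at p (Suc n) \<omega> \<le> V (Suc n) \<omega>)))) \<in> borel_measurable M"
      by measurable
  qed
  finally show ?thesis using p by (simp only: nn_integral_payment)
qed

text \<open>Valid without integrability: if the expectation is infinite, the Bochner integral and
  \<open>enn2real\<close> both return 0.\<close>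

lemma expected_revenue_eq_nn_integral:
  assumes p: "\<And>k. 0 \<le> p k"
  shows "expected_revenue M U S V p t =
    enn2real (\<integral>\<^sup>+\<omega>. ennreal (revenue p (\<lambda>n. U n \<omega>) (\<lambda>n. S n \<omega>) (\<lambda>n. V n \<omega>) t) \<partial>M)"
  unfolding expected_revenue_def
  by (rule integral_eq_nn_integral[OF measurable_revenue])
    (auto simp: revenue_def posted_price_def intro!: AE_I2 sum_nonneg p)

lemma suminf_event_prob_mult:
  assumes "0 \<le> c"
  shows "(\<Sum>n. ennreal (arrivals.event_prob t (Suc n) * c)) = ennreal (arrivals.renewal_function t * c)"
    and "0 \<le> arrivals.renewal_function t"
proof -
  have s: "summable (\<lambda>n. arrivals.event_prob t (Suc n))"
    using arrivals.summable_event_prob[of t] by (simp only: summable_Suc_iff)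
  show "(\<Sum>n. ennreal (arrivals.event_prob t (Suc n) * c)) = ennreal (arrivals.renewal_function t * c)"
    unfolding arrivals.renewal_function_def suminf_mult2[OF s]
    using assms by (intro suminf_ennreal2 summable_mult2 s) (simp add: arrivals.event_prob_nonneg)
  show "0 \<le> arrivals.renewal_function t"
    unfolding arrivals.renewal_function_def
    by (intro suminf_nonneg s arrivals.event_prob_nonneg)
qed

lemma expected_revenue_uniform:
  assumes c: "0 \<le> c"
  shows "expected_revenue M U S V (\<lambda>_. c) t = arrivals.renewal_function t * (c * valuation_tail M V c)"
proof -
  have "0 \<le> c * valuation_tail M V c" using c by (simp add: valuation_tail_def)
  with c show ?thesis
    by (simp add: expected_revenue_eq_nn_integral nn_integral_revenue posted_price_def
        nn_integral_arrival suminf_event_prob_mult)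
qed

lemma expected_revenue_le:
  assumes p: "\<And>k. 0 \<le> p k" and r: "\<And>k. p k * valuation_tail M V (p k) \<le> r"
  shows "expected_revenue M U S V p t \<le> arrivals.renewal_function t * r"
proof -
  have "0 \<le> p 0 * valuation_tail M V (p 0)" using p by (simp add: valuation_tail_def)
  with r[of 0] have r0: "0 \<le> r" by simp
  have "(\<integral>\<^sup>+\<omega>. ennreal (revenue p (\<lambda>n. U n \<omega>) (\<lambda>n. S n \<omega>) (\<lambda>n. V n \<omega>) t) \<partial>M) \<le>
      (\<Sum>n. \<integral>\<^sup>+\<omega>. ennreal (of_bool (arrivals.event_time (Suc n) \<omega> \<le> t) * r) \<partial>M)"
    unfolding nn_integral_revenue[OF p]
    by (intro suminf_le nn_integral_mono ennreal_leI mult_left_mono)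
      (auto simp: posted_price_def r)
  also have "\<dots> = ennreal (arrivals.renewal_function t * r)"
    using r0 by (simp add: nn_integral_arrival suminf_event_prob_mult)
  \<comment> \<open>The right-hand side is a finite real, so the bound excludes the infinite case
    and passes through \<open>enn2real\<close>.\<close>
  finally show ?thesis
    unfolding expected_revenue_eq_nn_integral[OF p]
    by (rule enn2real_leI[rotated]) (simp add: r0 suminf_event_prob_mult(2)[OF r0])
qed

lemma revenue_rate_bound_tendsto:
  "((\<lambda>t. arrivals.renewal_function t * r / t) \<longlongrightarrow> arr_rate * r) at_top"
  using tendsto_mult_right[OF arrivals.elementary_renewal, of r] unfolding U_mean by simp

lemma revenue_rate_uniform:
  assumes "0 \<le> c"
  shows "((\<lambda>t. expected_revenue M U S V (\<lambda>_. c) t / t) \<longlongrightarrow>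
    arr_rate * (c * valuation_tail M V c)) at_top"
  unfolding expected_revenue_uniform[OF assms] by (rule revenue_rate_bound_tendsto)

end

theorem proposition11:
  fixes M :: "'a measure"
    and U S V :: "nat \<Rightarrow> 'a \<Rightarrow> real"
    and arr_rate srv_rate pstar :: real
  assumes "infinite_server_pricing M U S V arr_rate srv_rate"
    and "is_arg_max (\<lambda>x. x * valuation_tail M V x) (\<lambda>x. 0 \<le> x) pstar"
  shows "revenue_rate_exists M U S V (\<lambda>_. pstar) \<and>
         mean_revenue_rate M U S V (\<lambda>_. pstar) = arr_rate * pstar * valuation_tail M V pstar \<and>
         (\<forall>p. (\<forall>k. 0 \<le> p k) \<and> revenue_rate_exists M U S V p \<longrightarrow>
              mean_revenue_rate M U S V p \<le> mean_revenue_rate M U S V (\<lambda>_. pstar))"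
proof -
  interpret infinite_server_pricing M U S V arr_rate srv_rate by fact
  define r where "r = pstar * valuation_tail M V pstar"
  have max: "x * valuation_tail M V x \<le> r" if "0 \<le> x" for x
    using assms(2) that by (auto simp: is_arg_max_def r_def not_less)
  have uniform: "((\<lambda>t. expected_revenue M U S V (\<lambda>_. pstar) t / t) \<longlongrightarrow> arr_rate * r) at_top"
    unfolding r_def using assms(2) by (intro revenue_rate_uniform) (simp add: is_arg_max_def)
  then have rate: "mean_revenue_rate M U S V (\<lambda>_. pstar) = arr_rate * r"
    unfolding mean_revenue_rate_def by (intro tendsto_Lim) auto
  have "mean_revenue_rate M U S V p \<le> arr_rate * r"
    if p: "\<forall>k. 0 \<le> p k" and exists: "revenue_rate_exists M U S V p" for p
  proof -
    obtain l where l: "((\<lambda>t. expected_revenue M U S V p t / t) \<longlongrightarrow> l) at_top"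
      using exists unfolding revenue_rate_exists_def by blast
    \<comment> \<open>For each \<open>t > 0\<close> the right-hand side is exactly the revenue per
      unit time of the uniform price, so the uniform price is at least as good at every finite
      horizon.\<close>
    have "\<forall>\<^sub>F t in at_top. expected_revenue M U S V p t / t \<le> arrivals.renewal_function t * r / t"
      using eventually_gt_at_top[of 0]
      by eventually_elim (intro divide_right_mono expected_revenue_le max; use p in simp)
    then have "l \<le> arr_rate * r"
      by (rule tendsto_le[OF trivial_limit_at_top_linorder revenue_rate_bound_tendsto l])
    moreover have "mean_revenue_rate M U S V p = l"
      unfolding mean_revenue_rate_def using l by (intro tendsto_Lim) auto
    ultimately show ?thesis by simp
  qed
  with uniform rate show ?thesis
    unfolding revenue_rate_exists_def by (auto simp: r_def mult.assoc)
qed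

end
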